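(* The set $I^{\forall}_{TD} = \{e : (\forall L \in \mathcal L_e)[\mathrm{TD}(L,\mathcal L_e) < \infty]\}$ is $\Pi^0_4$-complete.
   Context: $W_0,W_1,\ldots$ is an acceptable numbering of all r.e. subsets of $\mathbb N$; $L^e_j = \{x : \langle j,x\rangle \in W_e\}$ and $\mathcal L_e = \{L^e_j : j\in\mathbb N\}$. For a family $\mathcal L$ of subsets of $\mathbb N$ and $L\in\mathcal L$: a set $T\subseteq \mathbb N\times\{+,-\}$ of labelled examples, with $T^+=\{n:(n,+)\in T\}$ and $T^-=\{n:(n,-)\in T\}$, is consistent with a set $L'$ iff $T^+\subseteq L'$ and $T^-\cap L'=\emptyset$; $T$ is a teaching set for $L$ w.r.t. $\mathcal L$ iff $T$ is consistent with $L$ and with no $L'\in\mathcal L\setminus\{L\}$. $\mathrm{TD}(L,\mathcal L)$ is the size of a smallest teaching set for $L$ w.r.t. $\mathcal L$ ($\infty$ if there is no finite one). $\Pi^0_n$-complete means definable by a $\Pi^0_n$ formula and every $\Pi^0_n$ set many-one reduces to it via a recursive function. *)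

theory Defs
  imports Complex_Main "HOL-Library.Nat_Bijection" "HOL-Library.Extended_Nat"
begin

text \<open>
  Total recursive functions of arity \<open>k\<close> are functions on argument lists, of which only the
  values on lists of length \<open>k\<close> matter (hence rule \<open>ext\<close>). Minimization is restricted to
  regular functions, so that all functions in the class are total.
\<close>

inductive recursive_fn :: "nat \<Rightarrow> (nat list \<Rightarrow> nat) \<Rightarrow> bool" where
  zero: "recursive_fn k (\<lambda>xs. 0)"
| succ: "recursive_fn 1 (\<lambda>xs. Suc (hd xs))"
| proj: "i < k \<Longrightarrow> recursive_fn k (\<lambda>xs. xs ! i)"
| comp: "recursive_fn (length gs) f \<Longrightarrow> \<forall>g\<in>set gs. recursive_fn k g
         \<Longrightarrow> recursive_fn k (\<lambda>xs. f (map (\<lambda>g. g xs) gs))"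
| prec: "recursive_fn k f \<Longrightarrow> recursive_fn (Suc (Suc k)) g
         \<Longrightarrow> recursive_fn (Suc k)
               (\<lambda>xs. rec_nat (f (tl xs)) (\<lambda>n r. g (n # r # tl xs)) (hd xs))"
| minim: "recursive_fn (Suc k) f \<Longrightarrow> \<forall>xs. length xs = k \<longrightarrow> (\<exists>n. f (n # xs) = 0)
         \<Longrightarrow> recursive_fn k (\<lambda>xs. LEAST n. f (n # xs) = 0)"
| ext: "recursive_fn k f \<Longrightarrow> \<forall>xs. length xs = k \<longrightarrow> g xs = f xs \<Longrightarrow> recursive_fn k g"

definition recursive :: "(nat \<Rightarrow> nat) \<Rightarrow> bool" where
  "recursive f \<longleftrightarrow> recursive_fn 1 (\<lambda>xs. f (hd xs))"

definition recursive_rel :: "nat \<Rightarrow> (nat list \<Rightarrow> bool) \<Rightarrow> bool" where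
  "recursive_rel k R \<longleftrightarrow> recursive_fn k (\<lambda>xs. if R xs then 1 else 0)"

definition re_set :: "nat set \<Rightarrow> bool" where
  "re_set A \<longleftrightarrow> A = {} \<or> (\<exists>f. recursive f \<and> A = range f)"

definition uniformly_re :: "(nat \<Rightarrow> nat set) \<Rightarrow> bool" where
  "uniformly_re V \<longleftrightarrow> re_set {prod_encode (e, x) | e x. x \<in> V e}"

text \<open>
  A numbering of the r.e. sets is acceptable if it is uniformly r.e. and every uniformly r.e.
  numbering translates recursively into it. Applying the latter to constant numberings, every
  r.e. set occurs in it.
\<close>

definition acceptable_numbering :: "(nat \<Rightarrow> nat set) \<Rightarrow> bool" where
  "acceptable_numbering W \<longleftrightarrow>
     uniformly_re W \<and>
     (\<forall>V. uniformly_re V \<longrightarrow> (\<exists>f. recursive f \<and> (\<forall>e. V e = W (f e))))"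

text \<open>
  \<open>Sigma_rel n k R\<close> and \<open>Pi_rel n k R\<close>: the \<open>k\<close>-ary relation \<open>R\<close> is defined by a prefix of \<open>n\<close>
  alternating number quantifiers, starting with an existential respectively universal one, in
  front of a recursive relation. Each quantified variable is put at the head of the argument list.
\<close>

fun Sigma_rel :: "nat \<Rightarrow> nat \<Rightarrow> (nat list \<Rightarrow> bool) \<Rightarrow> bool"
  and Pi_rel :: "nat \<Rightarrow> nat \<Rightarrow> (nat list \<Rightarrow> bool) \<Rightarrow> bool" where
  "Sigma_rel 0 k R \<longleftrightarrow> recursive_rel k R"
| "Sigma_rel (Suc n) k R \<longleftrightarrow>
     (\<exists>S. Pi_rel n (Suc k) S \<and> (\<forall>xs. length xs = k \<longrightarrow> (R xs \<longleftrightarrow> (\<exists>y. S (y # xs)))))"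
| "Pi_rel 0 k R \<longleftrightarrow> recursive_rel k R"
| "Pi_rel (Suc n) k R \<longleftrightarrow>
     (\<exists>S. Sigma_rel n (Suc k) S \<and> (\<forall>xs. length xs = k \<longrightarrow> (R xs \<longleftrightarrow> (\<forall>y. S (y # xs)))))"

definition Pi_set :: "nat \<Rightarrow> nat set \<Rightarrow> bool" where
  "Pi_set n A \<longleftrightarrow> Pi_rel n 1 (\<lambda>xs. hd xs \<in> A)"

definition many_one_reducible :: "nat set \<Rightarrow> nat set \<Rightarrow> bool" where
  "many_one_reducible B A \<longleftrightarrow> (\<exists>f. recursive f \<and> (\<forall>x. x \<in> B \<longleftrightarrow> f x \<in> A))"

definition Pi_complete :: "nat \<Rightarrow> nat set \<Rightarrow> bool" where
  "Pi_complete n A \<longleftrightarrow> Pi_set n A \<and> (\<forall>B. Pi_set n B \<longrightarrow> many_one_reducible B A)"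

datatype label = Plus | Minus

definition positives :: "(nat \<times> label) set \<Rightarrow> nat set" where
  "positives T = {n. (n, Plus) \<in> T}"

definition negatives :: "(nat \<times> label) set \<Rightarrow> nat set" where
  "negatives T = {n. (n, Minus) \<in> T}"

definition consistent :: "(nat \<times> label) set \<Rightarrow> nat set \<Rightarrow> bool" where
  "consistent T L \<longleftrightarrow> positives T \<subseteq> L \<and> negatives T \<inter> L = {}"

definition teaching_set :: "(nat \<times> label) set \<Rightarrow> nat set \<Rightarrow> nat set set \<Rightarrow> bool" where
  "teaching_set T L \<L> \<longleftrightarrow> consistent T L \<and> (\<forall>L'\<in>\<L> - {L}. \<not> consistent T L')"

text \<open>The infimum of the empty set in \<^typ>\<open>enat\<close> is \<open>\<infinity>\<close>.\<close>

definition TD :: "nat set \<Rightarrow> nat set set \<Rightarrow> enat" where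
  "TD L \<L> = Inf {enat (card T) | T. finite T \<and> teaching_set T L \<L>}"

definition language :: "(nat \<Rightarrow> nat set) \<Rightarrow> nat \<Rightarrow> nat \<Rightarrow> nat set" where
  "language W e j = {x. prod_encode (j, x) \<in> W e}"

definition family :: "(nat \<Rightarrow> nat set) \<Rightarrow> nat \<Rightarrow> nat set set" where
  "family W e = range (language W e)"

definition I_TD_all :: "(nat \<Rightarrow> nat set) \<Rightarrow> nat set" where
  "I_TD_all W = {e. \<forall>L\<in>family W e. TD L (family W e) < \<infinity>}"

end

theory Submission
  imports Defs
begin

text \<open>
  \<open>L\<close> has a finite teaching set w.r.t. a family iff for some \<open>n\<close> every member of the family that
  agrees with \<open>L\<close> below \<open>n\<close> is equal to \<open>L\<close>. For r.e. languages the implication ``agreement below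
  \<open>n\<close> implies equality'' is \<open>\<Pi>\<^sub>2\<close>, uniformly in \<open>n\<close> and the indices, which gives the \<open>\<Pi>\<^sub>4\<close> upper
  bound.

  For hardness, let \<open>x \<in> B \<longleftrightarrow> (\<forall>a. \<exists>b. \<forall>c. \<exists>d. R(d, c, b, a, x))\<close>. For every \<open>a\<close> put into a
  separate column \<open>{\<langle>a, n\<rangle> | n}\<close> the whole column and, for every \<open>i > 0\<close>, the initial segment of those
  \<open>\<langle>a, n\<rangle>\<close> for which \<open>n < i\<close> or some \<open>b < i\<close> satisfies \<open>\<forall>c\<le>n. \<exists>d. R(d, c, b, a, x)\<close>. If some \<open>b\<close>
  witnesses \<open>a\<close>, only finitely many of the segments are proper, and finitely many examples separate
  the whole column from them. Otherwise all of them are proper but arbitrarily long, so the whole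
  column has no finite teaching set. A proper initial segment is taught by its last element and the
  first one missing, and its elements identify the column.
\<close>

section \<open>Closure properties of recursive functions\<close>

lemma recursive_fn_cong:
  assumes "recursive_fn k f" "\<And>xs. length xs = k \<Longrightarrow> g xs = f xs"
  shows "recursive_fn k g"
  using assms recursive_fn.ext by blast

section \<open>Projections under iterated tails\<close>

lemma recursive_fn_nth: "i < k \<Longrightarrow> recursive_fn k (\<lambda>xs. xs ! i)"
  by (rule recursive_fn.proj)

text \<open>Recursion and bounded quantifiers push new variables onto the front of the argument
  list, so older ones occur under iterated \<open>tl\<close>.\<close>

lemma recursive_fn_drop_nth: "i + n < k \<Longrightarrow> recursive_fn k (\<lambda>xs. (tl ^^ n) xs ! i)"
proof (rule recursive_fn_cong[OF recursive_fn.proj])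
  fix xs :: "nat list"
  assume "i + n < k" "length xs = k"
  moreover have "(tl ^^ n) xs = drop n xs"
    by (induction n) (simp_all add: drop_Suc tl_drop)
  ultimately show "(tl ^^ n) xs ! i = xs ! (i + n)"
    by (simp add: add.commute)
qed

lemma recursive_fn_tl_nth: "i + 1 < k \<Longrightarrow> recursive_fn k (\<lambda>xs. tl xs ! i)"
  using recursive_fn_drop_nth[of i 1 k] by simp

lemma recursive_fn_tl2_nth: "i + 2 < k \<Longrightarrow> recursive_fn k (\<lambda>xs. tl (tl xs) ! i)"
  using recursive_fn_drop_nth[of i 2 k] by (simp add: numeral_2_eq_2)

lemma recursive_fn_tl3_nth: "i + 3 < k \<Longrightarrow> recursive_fn k (\<lambda>xs. tl (tl (tl xs)) ! i)"
  using recursive_fn_drop_nth[of i 3 k] by (simp add: numeral_3_eq_3)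

lemma recursive_fn_hd: "0 < k \<Longrightarrow> recursive_fn k hd"
  by (rule recursive_fn_cong[OF recursive_fn.proj[of 0]]) (auto simp: hd_conv_nth)

lemma recursive_fn_tl_hd: "1 < k \<Longrightarrow> recursive_fn k (\<lambda>xs. hd (tl xs))"
  by (rule recursive_fn_cong[OF recursive_fn_tl_nth[of 0]])
     (auto simp: hd_conv_nth simp flip: length_greater_0_conv)

lemma recursive_fn_tl2_hd: "2 < k \<Longrightarrow> recursive_fn k (\<lambda>xs. hd (tl (tl xs)))"
  by (rule recursive_fn_cong[OF recursive_fn_tl2_nth[of 0]])
     (auto simp: hd_conv_nth simp flip: length_greater_0_conv)

lemmas recursive_fn_vars =
  recursive_fn_nth recursive_fn_tl_nth recursive_fn_tl2_nth recursive_fn_tl3_nth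
  recursive_fn_hd recursive_fn_tl_hd recursive_fn_tl2_hd

section \<open>Composition and recursion with parameters\<close>

lemma recursive_fn_comp1:
  assumes "recursive_fn 1 (\<lambda>xs. f (hd xs))" "recursive_fn k g"
  shows "recursive_fn k (\<lambda>xs. f (g xs))"
  using recursive_fn.comp[of "[g]" "\<lambda>xs. f (hd xs)" k] assms by simp

lemma recursive_fn_Suc: "recursive_fn k f \<Longrightarrow> recursive_fn k (\<lambda>xs. Suc (f xs))"
  by (rule recursive_fn_comp1[OF recursive_fn.succ])

lemma recursive_fn_const: "recursive_fn k (\<lambda>xs. c)"
  by (induction c) (auto intro: recursive_fn.zero recursive_fn_Suc)

text \<open>Rule \<open>prec\<close> recurses on the first argument. Composing with \<open>h\<close>
  followed by all projections turns this argument into an arbitrary function of the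
  parameters.\<close>

lemma recursive_fn_rec_nat:
  assumes "recursive_fn k h" "recursive_fn k f"
    and "recursive_fn (Suc (Suc k)) (\<lambda>xs. g (hd xs) (hd (tl xs)) (tl (tl xs)))"
  shows "recursive_fn k (\<lambda>xs. rec_nat (f xs) (\<lambda>n r. g n r xs) (h xs))"
proof -
  let ?gs = "h # map (\<lambda>i xs. xs ! i) [0..<k]"
  have "recursive_fn (length ?gs) (\<lambda>xs. rec_nat (f (tl xs)) (\<lambda>n r. g n r (tl xs)) (hd xs))"
    using recursive_fn.prec[OF assms(2,3)] by simp
  moreover have "\<forall>g\<in>set ?gs. recursive_fn k g"
    using assms(1) by (auto intro: recursive_fn.proj)
  ultimately
  have "recursive_fn k (\<lambda>xs. rec_nat (f (tl (map (\<lambda>g. g xs) ?gs)))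
      (\<lambda>n r. g n r (tl (map (\<lambda>g. g xs) ?gs))) (hd (map (\<lambda>g. g xs) ?gs)))"
    by (rule recursive_fn.comp)
  moreover have "map (\<lambda>g. g xs) ?gs = h xs # xs" if "length xs = k" for xs
    using that by (auto simp: o_def map_nth)
  ultimately show ?thesis
    by (elim recursive_fn_cong) simp
qed

lemma recursive_fn_Least:
  assumes "recursive_fn (Suc k) (\<lambda>xs. f (hd xs) (tl xs))"
    and "\<And>xs. length xs = k \<Longrightarrow> \<exists>n. f n xs = 0"
  shows "recursive_fn k (\<lambda>xs. LEAST n. f n xs = 0)"
  using recursive_fn.minim[OF assms(1)] assms(2) by simp

section \<open>Arithmetic, pairing and case distinction\<close>

lemma recursive_fn_add:
  assumes "recursive_fn k f" "recursive_fn k g"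
  shows "recursive_fn k (\<lambda>xs. f xs + g xs)"
proof -
  have "recursive_fn k (\<lambda>xs. rec_nat (f xs) (\<lambda>n r. Suc r) (g xs))"
    by (intro recursive_fn_rec_nat recursive_fn_Suc recursive_fn_vars assms) simp
  moreover have "rec_nat a (\<lambda>n r. Suc r) b = a + b" for a b
    by (induction b) simp_all
  ultimately show ?thesis by simp
qed

lemma recursive_fn_pred:
  assumes "recursive_fn k f"
  shows "recursive_fn k (\<lambda>xs. f xs - 1)"
proof -
  have "recursive_fn k (\<lambda>xs. rec_nat 0 (\<lambda>n r. n) (f xs))"
    by (intro recursive_fn_rec_nat recursive_fn_const recursive_fn_vars assms) simp
  moreover have "rec_nat 0 (\<lambda>n r. n) a = a - 1" for a
    by (cases a) simp_all
  ultimately show ?thesis by simp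
qed

lemma recursive_fn_diff:
  assumes "recursive_fn k f" "recursive_fn k g"
  shows "recursive_fn k (\<lambda>xs. f xs - g xs)"
proof -
  have "recursive_fn k (\<lambda>xs. rec_nat (f xs) (\<lambda>n r. r - 1) (g xs))"
    by (intro recursive_fn_rec_nat recursive_fn_pred recursive_fn_vars assms) simp
  moreover have "rec_nat a (\<lambda>n r. r - 1) b = a - b" for a b :: nat
    by (induction b) simp_all
  ultimately show ?thesis by simp
qed

lemma recursive_fn_triangle:
  assumes "recursive_fn k f"
  shows "recursive_fn k (\<lambda>xs. triangle (f xs))"
proof -
  have "recursive_fn k (\<lambda>xs. rec_nat 0 (\<lambda>n r. r + Suc n) (f xs))"
    by (intro recursive_fn_rec_nat recursive_fn_add recursive_fn_Suc recursive_fn_const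
        recursive_fn_vars assms) simp_all
  moreover have "rec_nat 0 (\<lambda>n r. r + Suc n) a = triangle a" for a
    by (induction a) simp_all
  ultimately show ?thesis by simp
qed

lemma recursive_fn_prod_encode:
  assumes "recursive_fn k f" "recursive_fn k g"
  shows "recursive_fn k (\<lambda>xs. prod_encode (f xs, g xs))"
  unfolding prod_encode_def
  by (simp add: assms recursive_fn_add recursive_fn_triangle)

text \<open>This is a recursion along the characteristic function of \<open>P\<close>: zero steps
  return \<open>g\<close>, one step returns \<open>f\<close>.\<close>

lemma recursive_fn_if:
  assumes "recursive_rel k P" "recursive_fn k f" "recursive_fn k g"
  shows "recursive_fn k (\<lambda>xs. if P xs then f xs else g xs)"
proof -
  have "recursive_fn k (\<lambda>xs. rec_nat (g xs) (\<lambda>n r. f xs) (if P xs then 1 else 0))"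
  proof (rule recursive_fn_rec_nat)
    \<comment> \<open>These projections skip the counter and the previous value, so \<open>f\<close>
      sees only the parameters.\<close>
    let ?gs = "map (\<lambda>i xs. xs ! (i + 2)) [0..<k]"
    have "recursive_fn (length ?gs) f"
      using assms by simp
    moreover have "\<forall>g\<in>set ?gs. recursive_fn (Suc (Suc k)) g"
      by (auto intro: recursive_fn.proj)
    ultimately have "recursive_fn (Suc (Suc k)) (\<lambda>xs. f (map (\<lambda>g. g xs) ?gs))"
      by (rule recursive_fn.comp)
    then show "recursive_fn (Suc (Suc k)) (\<lambda>xs. f (tl (tl xs)))"
      by (rule recursive_fn_cong)
         (auto intro!: arg_cong[where f = f] nth_equalityI simp: nth_tl)
  qed (use assms in \<open>simp_all add: recursive_rel_def\<close>)
  then show ?thesis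
    by (rule recursive_fn_cong) simp
qed

section \<open>Closure properties of recursive relations\<close>

lemma recursive_rel_eq_0:
  assumes "recursive_fn k f"
  shows "recursive_rel k (\<lambda>xs. f xs = 0)"
proof -
  have "recursive_fn k (\<lambda>xs. 1 - f xs)"
    by (intro recursive_fn_diff recursive_fn_const assms)
  then show ?thesis
    unfolding recursive_rel_def by (rule recursive_fn_cong) simp
qed

lemma recursive_rel_iff_0:
  assumes "recursive_fn k f" "\<And>xs. P xs \<longleftrightarrow> f xs = 0"
  shows "recursive_rel k P"
  unfolding assms(2) by (rule recursive_rel_eq_0[OF assms(1)])

lemma recursive_rel_le:
  assumes "recursive_fn k f" "recursive_fn k g"
  shows "recursive_rel k (\<lambda>xs. f xs \<le> g xs)"
  by (rule recursive_rel_iff_0[where f = "\<lambda>xs. f xs - g xs"])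
     (auto intro: assms recursive_fn_diff)

lemma recursive_rel_less:
  assumes "recursive_fn k f" "recursive_fn k g"
  shows "recursive_rel k (\<lambda>xs. f xs < g xs)"
proof -
  have "recursive_rel k (\<lambda>xs. Suc (f xs) \<le> g xs)"
    by (intro recursive_rel_le recursive_fn_Suc assms)
  then show ?thesis
    by (simp only: Suc_le_eq)
qed

lemma recursive_rel_eq:
  assumes "recursive_fn k f" "recursive_fn k g"
  shows "recursive_rel k (\<lambda>xs. f xs = g xs)"
  by (rule recursive_rel_iff_0[where f = "\<lambda>xs. (f xs - g xs) + (g xs - f xs)"])
     (auto intro!: assms recursive_fn_diff recursive_fn_add)

lemma recursive_rel_not:
  assumes "recursive_rel k P"
  shows "recursive_rel k (\<lambda>xs. \<not> P xs)"
  by (rule recursive_rel_iff_0[OF assms[unfolded recursive_rel_def]]) simp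

lemma recursive_rel_conj:
  assumes "recursive_rel k P" "recursive_rel k Q"
  shows "recursive_rel k (\<lambda>xs. P xs \<and> Q xs)"
  using recursive_fn_if[OF assms(1) assms(2)[unfolded recursive_rel_def] recursive_fn_const[of _ 0]]
  unfolding recursive_rel_def by (rule recursive_fn_cong) simp

lemma recursive_rel_disj:
  assumes "recursive_rel k P" "recursive_rel k Q"
  shows "recursive_rel k (\<lambda>xs. P xs \<or> Q xs)"
proof -
  have "recursive_rel k (\<lambda>xs. \<not> (\<not> P xs \<and> \<not> Q xs))"
    by (intro recursive_rel_not recursive_rel_conj assms)
  then show ?thesis
    by (simp only: de_Morgan_conj not_not)
qed

lemma recursive_rel_imp:
  assumes "recursive_rel k P" "recursive_rel k Q"
  shows "recursive_rel k (\<lambda>xs. P xs \<longrightarrow> Q xs)"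
proof -
  have "recursive_rel k (\<lambda>xs. \<not> P xs \<or> Q xs)"
    by (intro recursive_rel_not recursive_rel_disj assms)
  then show ?thesis
    by (simp only: imp_conv_disj)
qed

lemma recursive_rel_iff:
  assumes "recursive_rel k P" "recursive_rel k Q"
  shows "recursive_rel k (\<lambda>xs. P xs \<longleftrightarrow> Q xs)"
proof -
  have "recursive_rel k (\<lambda>xs. (P xs \<longrightarrow> Q xs) \<and> (Q xs \<longrightarrow> P xs))"
    by (intro recursive_rel_imp recursive_rel_conj assms)
  then show ?thesis
    by (simp only: iff_conv_conj_imp)
qed

lemma recursive_rel_const: "recursive_rel k (\<lambda>xs. P)"
  unfolding recursive_rel_def by (rule recursive_fn_const)

lemma recursive_rel_comp:
  assumes "recursive_rel (length gs) R" "\<forall>g\<in>set gs. recursive_fn k g"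
  shows "recursive_rel k (\<lambda>xs. R (map (\<lambda>g. g xs) gs))"
  using recursive_fn.comp[OF assms[unfolded recursive_rel_def]] unfolding recursive_rel_def .

text \<open>A primitive recursion runs through the candidates below the bound; its accumulator
  becomes 1 at the first witness and stays 1.\<close>

lemma recursive_rel_ex_less:
  assumes "recursive_rel (Suc k) (\<lambda>xs. P (hd xs) (tl xs))" "recursive_fn k f"
  shows "recursive_rel k (\<lambda>xs. \<exists>i<f xs. P i xs)"
proof -
  \<comment> \<open>Position 1 holds the accumulator and is left out, since \<open>P\<close> looks
    only at the counter and the parameters.\<close>
  let ?gs = "(\<lambda>xs. xs ! 0) # map (\<lambda>i xs. xs ! (i + 2)) [0..<k]"
  have "recursive_rel (length ?gs) (\<lambda>xs. P (hd xs) (tl xs))"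
    using assms by simp
  moreover have "\<forall>g\<in>set ?gs. recursive_fn (Suc (Suc k)) g"
    by (auto intro: recursive_fn.proj)
  ultimately have "recursive_rel (Suc (Suc k))
      (\<lambda>xs. P (hd (map (\<lambda>g. g xs) ?gs)) (tl (map (\<lambda>g. g xs) ?gs)))"
    by (rule recursive_rel_comp)
  then have "recursive_rel (Suc (Suc k)) (\<lambda>xs. P (xs ! 0) (map (\<lambda>i. xs ! (i + 2)) [0..<k]))"
    by (simp add: o_def)
  then have "recursive_rel (Suc (Suc k)) (\<lambda>xs. P (hd xs) (tl (tl xs)))"
    unfolding recursive_rel_def
  proof (rule recursive_fn_cong)
    fix xs :: "nat list"
    assume len: "length xs = Suc (Suc k)"
    then have "tl (tl xs) = map (\<lambda>i. xs ! (i + 2)) [0..<k]"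
      by (intro nth_equalityI) (simp_all add: nth_tl)
    moreover have "hd xs = xs ! 0"
      using len by (intro hd_conv_nth) auto
    ultimately show "(if P (hd xs) (tl (tl xs)) then 1 else 0) =
        (if P (xs ! 0) (map (\<lambda>i. xs ! (i + 2)) [0..<k]) then 1 else (0::nat))"
      by simp
  qed
  then have "recursive_fn k
      (\<lambda>xs. rec_nat 0 (\<lambda>i r. if P i xs then 1 else r) (f xs))"
    by (intro recursive_fn_rec_nat recursive_fn_if recursive_fn_vars recursive_fn_const assms) simp_all
  moreover have "rec_nat 0 (\<lambda>i r. if P i xs then 1 else r) n = (if \<exists>i<n. P i xs then 1 else (0::nat))"
    for n xs by (induction n) (auto simp: less_Suc_eq)
  ultimately show ?thesis
    unfolding recursive_rel_def by simp
qed

lemma recursive_rel_all_less: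
  assumes "recursive_rel (Suc k) (\<lambda>xs. P (hd xs) (tl xs))" "recursive_fn k f"
  shows "recursive_rel k (\<lambda>xs. \<forall>i<f xs. P i xs)"
proof -
  have "recursive_rel k (\<lambda>xs. \<not> (\<exists>i<f xs. \<not> P i xs))"
    by (intro recursive_rel_not recursive_rel_ex_less assms)
  then show ?thesis
    by (simp only: not_ex de_Morgan_conj not_not imp_conv_disj)
qed

lemmas recursive_rel_intros =
  recursive_rel_conj recursive_rel_disj recursive_rel_imp recursive_rel_iff recursive_rel_not
  recursive_rel_ex_less recursive_rel_all_less recursive_rel_eq recursive_rel_le recursive_rel_less

section \<open>Minimization over relations and decoding of pairs\<close>

lemma recursive_fn_Least_rel:
  assumes "recursive_rel (Suc k) (\<lambda>xs. P (hd xs) (tl xs))"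
    and "\<And>xs. length xs = k \<Longrightarrow> \<exists>n. P n xs"
  shows "recursive_fn k (\<lambda>xs. LEAST n. P n xs)"
proof -
  \<comment> \<open>Minimization looks for a zero, hence the characteristic function of the
    negation.\<close>
  have "recursive_fn k (\<lambda>xs. LEAST n. (if \<not> P n xs then 1 else 0) = (0::nat))"
    using assms recursive_rel_not[OF assms(1)]
    by (intro recursive_fn_Least) (auto simp: recursive_rel_def)
  then show ?thesis
    by (rule recursive_fn_cong) simp
qed

text \<open>The first component is found by search. A code is at least as large as its components,
  so the second one can be quantified below it.\<close>

lemma recursive_fn_fst_prod_decode:
  assumes "recursive_fn k f"
  shows "recursive_fn k (\<lambda>xs. fst (prod_decode (f xs)))"
proof (rule recursive_fn_comp1[where f = "\<lambda>z. fst (prod_decode z)", OF _ assms])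
  have "recursive_fn 1 (\<lambda>xs. LEAST a. \<exists>b<Suc (xs ! 0). prod_encode (a, b) = xs ! 0)"
  proof (rule recursive_fn_Least_rel)
    fix xs :: "nat list"
    obtain a b where "xs ! 0 = prod_encode (a, b)"
      by (metis prod_decode_inverse surj_pair)
    then show "\<exists>a. \<exists>b<Suc (xs ! 0). prod_encode (a, b) = xs ! 0"
      using le_prod_encode_2[of b a] by (auto simp: less_Suc_eq_le)
  qed (intro recursive_rel_intros recursive_fn_prod_encode recursive_fn_Suc recursive_fn_vars; simp)
  then show "recursive_fn 1 (\<lambda>xs. fst (prod_decode (hd xs)))"
  proof (rule recursive_fn_cong)
    fix xs :: "nat list"
    assume "length xs = 1"
    then have hd: "hd xs = xs ! 0"
      by (auto simp: length_Suc_conv)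
    obtain a b where ab: "xs ! 0 = prod_encode (a, b)"
      by (metis prod_decode_inverse surj_pair)
    have least: "(LEAST a. \<exists>b<Suc (xs ! 0). prod_encode (a, b) = xs ! 0) = a"
    proof (rule Least_equality)
      show "\<exists>b<Suc (xs ! 0). prod_encode (a, b) = xs ! 0"
        using ab le_prod_encode_2[of b a] by (auto simp: less_Suc_eq_le)
      show "a \<le> a'" if "\<exists>b<Suc (xs ! 0). prod_encode (a', b) = xs ! 0" for a'
        using that ab by fastforce
    qed
    show "fst (prod_decode (hd xs)) = (LEAST a. \<exists>b<Suc (xs ! 0). prod_encode (a, b) = xs ! 0)"
      unfolding least hd by (simp add: ab)
  qed
qed

lemma recursive_fn_snd_prod_decode:
  assumes "recursive_fn k f"
  shows "recursive_fn k (\<lambda>xs. snd (prod_decode (f xs)))"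
proof (rule recursive_fn_comp1[where f = "\<lambda>z. snd (prod_decode z)", OF _ assms])
  have "recursive_fn 1 (\<lambda>xs. LEAST b. prod_encode (fst (prod_decode (xs ! 0)), b) = xs ! 0)"
  proof (rule recursive_fn_Least_rel)
    show "\<exists>b. prod_encode (fst (prod_decode (xs ! 0)), b) = xs ! 0" for xs
      by (metis prod.collapse prod_decode_inverse)
  qed (intro recursive_rel_intros recursive_fn_prod_encode recursive_fn_fst_prod_decode
      recursive_fn_vars; simp)
  then show "recursive_fn 1 (\<lambda>xs. snd (prod_decode (hd xs)))"
  proof (rule recursive_fn_cong)
    fix xs :: "nat list"
    assume "length xs = 1"
    then have hd: "hd xs = xs ! 0"
      by (auto simp: length_Suc_conv)
    obtain a b where ab: "xs ! 0 = prod_encode (a, b)"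
      by (metis prod_decode_inverse surj_pair)
    then have "(LEAST b. prod_encode (fst (prod_decode (xs ! 0)), b) = xs ! 0) = b"
      by (intro Least_equality) auto
    then show "snd (prod_decode (hd xs)) =
        (LEAST b. prod_encode (fst (prod_decode (xs ! 0)), b) = xs ! 0)"
      using ab hd by simp
  qed
qed


lemma recursive_rel_app2:
  assumes "recursive_rel 2 R" "recursive_fn k f" "recursive_fn k g"
  shows "recursive_rel k (\<lambda>xs. R [f xs, g xs])"
  using recursive_rel_comp[of "[f, g]" R k] assms by (simp add: numeral_2_eq_2)

lemma recursive_rel_app5:
  assumes "recursive_rel 5 R" "recursive_fn k f1" "recursive_fn k f2" "recursive_fn k f3"
    "recursive_fn k f4" "recursive_fn k f5"
  shows "recursive_rel k (\<lambda>xs. R [f1 xs, f2 xs, f3 xs, f4 xs, f5 xs])"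
  using recursive_rel_comp[of "[f1, f2, f3, f4, f5]" R k] assms by (simp add: eval_nat_numeral)

lemmas recursive_fn_intros =
  recursive_fn_vars recursive_fn_const recursive_fn_Suc recursive_fn_prod_encode
  recursive_fn_fst_prod_decode recursive_fn_snd_prod_decode

section \<open>Recursively enumerable sets and \<open>\<Pi>\<^sub>4\<close> sets\<close>

text \<open>For a range, \<open>s\<close> is an argument at which the enumeration takes the value
  \<open>z\<close>. Conversely, all pairs of a stage and a candidate are run through, and confirmed
  candidates are output.\<close>

lemma re_set_iff: "re_set A \<longleftrightarrow> (\<exists>P. recursive_rel 2 P \<and> (\<forall>z. z \<in> A \<longleftrightarrow> (\<exists>s. P [s, z])))"
proof
  assume "re_set A"
  then consider "A = {}" | f where "recursive f" "A = range f"
    unfolding re_set_def by blast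
  then show "\<exists>P. recursive_rel 2 P \<and> (\<forall>z. z \<in> A \<longleftrightarrow> (\<exists>s. P [s, z]))"
  proof cases
    case 1
    then show ?thesis
      using recursive_rel_const[of 2 False] by auto
  next
    case 2
    have "recursive_rel 2 (\<lambda>xs. f (xs ! 0) = xs ! 1)"
      by (intro recursive_rel_eq recursive_fn_comp1[OF 2(1)[unfolded recursive_def]]
          recursive_fn_nth) simp_all
    with 2(2) show ?thesis
      by (intro exI[of _ "\<lambda>xs. f (xs ! 0) = xs ! 1"]) auto
  qed
next
  assume "\<exists>P. recursive_rel 2 P \<and> (\<forall>z. z \<in> A \<longleftrightarrow> (\<exists>s. P [s, z]))"
  then obtain P where P: "recursive_rel 2 P" "\<And>z. z \<in> A \<longleftrightarrow> (\<exists>s. P [s, z])"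
    by blast
  show "re_set A"
  proof (cases "A = {}")
    case False
    then obtain a where "a \<in> A" by blast
    \<comment> \<open>The default \<open>a\<close> keeps \<open>f\<close> total with values in
      \<open>A\<close>, which is why the empty set is split off.\<close>
    define f where "f u = (if P [fst (prod_decode u), snd (prod_decode u)]
      then snd (prod_decode u) else a)" for u
    have "recursive f"
      unfolding recursive_def f_def
      by (intro recursive_fn_if recursive_rel_app2[OF P(1)] recursive_fn_intros) simp_all
    moreover have "z \<in> range f" if "z \<in> A" for z
    proof -
      from that P(2) obtain s where "P [s, z]" by blast
      then have "f (prod_encode (s, z)) = z" by (simp add: f_def)
      then show ?thesis by (metis rangeI)
    qed
    moreover have "f u \<in> A" for u
      using P(2) \<open>a \<in> A\<close> by (auto simp: f_def)
    ultimately show ?thesis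
      unfolding re_set_def by blast
  qed (simp add: re_set_def)
qed

text \<open>Every number codes exactly one pair, so the normal form for the set of codes can be
  stated with index and element separated.\<close>

lemma uniformly_re_iff:
  "uniformly_re V \<longleftrightarrow>
    (\<exists>P. recursive_rel 2 P \<and> (\<forall>e x. x \<in> V e \<longleftrightarrow> (\<exists>s. P [s, prod_encode (e, x)])))"
proof -
  have mem: "prod_encode (e, x) \<in> {prod_encode (e, x) |e x. x \<in> V e} \<longleftrightarrow> x \<in> V e" for e x
    by (auto simp: prod_encode_eq)
  have "(\<forall>z. z \<in> {prod_encode (e, x) |e x. x \<in> V e} \<longleftrightarrow> (\<exists>s. P [s, z])) \<longleftrightarrow>
      (\<forall>e x. x \<in> V e \<longleftrightarrow> (\<exists>s. P [s, prod_encode (e, x)]))" (is "?l = ?r") for P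
  proof
    assume r: ?r
    show ?l
    proof
      fix z
      obtain e x where "z = prod_encode (e, x)"
        by (metis prod_decode_inverse surj_pair)
      with r mem show "z \<in> {prod_encode (e, x) |e x. x \<in> V e} \<longleftrightarrow> (\<exists>s. P [s, z])"
        by presburger
    qed
  next
    assume l: ?l
    show ?r
      by (intro allI) (rule trans[OF mem[symmetric] l[rule_format]])
  qed
  then show ?thesis
    unfolding uniformly_re_def re_set_iff by simp
qed

text \<open>Each level of the definition adds its variable at the head, so the innermost variable
  \<open>d\<close> comes first and the argument \<open>x\<close> last.\<close>

lemma Pi_set_4_iff:
  "Pi_set 4 A \<longleftrightarrow>
    (\<exists>R. recursive_rel 5 R \<and> (\<forall>x. x \<in> A \<longleftrightarrow> (\<forall>a. \<exists>b. \<forall>c. \<exists>d. R [d, c, b, a, x])))"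
proof
  assume "Pi_set 4 A"
  then obtain S1 where S1: "Sigma_rel 3 2 S1"
    and A: "\<And>xs. length xs = 1 \<Longrightarrow> hd xs \<in> A \<longleftrightarrow> (\<forall>y. S1 (y # xs))"
    unfolding eval_nat_numeral BitM.simps numeral_One One_nat_def 
      Pi_set_def Pi_rel.simps(2) by blast
  from S1 obtain S2 where S2: "Pi_rel 2 3 S2"
    and S1: "\<And>xs. length xs = 2 \<Longrightarrow> S1 xs \<longleftrightarrow> (\<exists>y. S2 (y # xs))"
    unfolding eval_nat_numeral BitM.simps numeral_One One_nat_def 
      Sigma_rel.simps(2) by blast
  from S2 obtain S3 where S3: "Sigma_rel 1 4 S3"
    and S2: "\<And>xs. length xs = 3 \<Longrightarrow> S2 xs \<longleftrightarrow> (\<forall>y. S3 (y # xs))"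
    unfolding eval_nat_numeral BitM.simps numeral_One One_nat_def 
      Pi_rel.simps(2) by blast
  from S3 obtain R where R: "recursive_rel 5 R"
    and S3: "\<And>xs. length xs = 4 \<Longrightarrow> S3 xs \<longleftrightarrow> (\<exists>y. R (y # xs))"
    unfolding eval_nat_numeral BitM.simps numeral_One One_nat_def 
      Sigma_rel.simps(2) Pi_rel.simps(1) by blast
  have "x \<in> A \<longleftrightarrow> (\<forall>a. \<exists>b. \<forall>c. \<exists>d. R [d, c, b, a, x])" for x
    using A[of "[x]"] by (simp add: S1 S2 S3)
  with R show "\<exists>R. recursive_rel 5 R \<and>
      (\<forall>x. x \<in> A \<longleftrightarrow> (\<forall>a. \<exists>b. \<forall>c. \<exists>d. R [d, c, b, a, x]))"
    by blast
next
  assume "\<exists>R. recursive_rel 5 R \<and> (\<forall>x. x \<in> A \<longleftrightarrow> (\<forall>a. \<exists>b. \<forall>c. \<exists>d. R [d, c, b, a, x]))"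
  then obtain R where R: "recursive_rel 5 R"
    and A: "\<And>x. x \<in> A \<longleftrightarrow> (\<forall>a. \<exists>b. \<forall>c. \<exists>d. R [d, c, b, a, x])"
    by blast
  from R have "Sigma_rel 1 4 (\<lambda>xs. \<exists>d. R (d # xs))"
    by (auto simp: eval_nat_numeral)
  then have "Pi_rel 2 3 (\<lambda>xs. \<forall>c. \<exists>d. R (d # c # xs))"
    by (auto simp: eval_nat_numeral simp del: Sigma_rel.simps)
  then have "Sigma_rel 3 2 (\<lambda>xs. \<exists>b. \<forall>c. \<exists>d. R (d # c # b # xs))"
    unfolding eval_nat_numeral BitM.simps numeral_One Sigma_rel.simps by blast
  moreover have "hd xs \<in> A \<longleftrightarrow> (\<forall>a. \<exists>b. \<forall>c. \<exists>d. R (d # c # b # a # xs))"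
    if "length xs = 1" for xs
    using that A[of "hd xs"] by (cases xs) auto
  ultimately have "Pi_rel 4 1 (\<lambda>xs. hd xs \<in> A)"
    unfolding eval_nat_numeral BitM.simps numeral_One One_nat_def Pi_rel.simps by blast
  then show "Pi_set 4 A"
    unfolding Pi_set_def .
qed

section \<open>Finite teaching dimension\<close>

text \<open>Consistency with \<open>L\<close> forces the labels, so only the set of labelled points
  matters: it must be finite and tell \<open>L\<close> from every other member.\<close>

lemma TD_finite_iff:
  "TD L F < \<infinity> \<longleftrightarrow> (\<exists>X. finite X \<and> (\<forall>L'\<in>F. L' \<inter> X = L \<inter> X \<longrightarrow> L' = L))"
proof
  assume "TD L F < \<infinity>"
  then obtain T where T: "finite T" "teaching_set T L F"
    unfolding TD_def Inf_less_iff by blast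
  have "L' = L" if "L' \<in> F" "L' \<inter> fst ` T = L \<inter> fst ` T" for L'
  proof -
    have "n \<in> L' \<longleftrightarrow> n \<in> L" if "(n, l) \<in> T" for n l
    proof -
      from that have "n \<in> fst ` T" by force
      with \<open>L' \<inter> fst ` T = L \<inter> fst ` T\<close> show ?thesis by blast
    qed
    moreover have "consistent T L"
      using T(2) unfolding teaching_set_def by blast
    ultimately have "consistent T L'"
      unfolding consistent_def positives_def negatives_def by blast
    with T(2) that(1) show ?thesis
      unfolding teaching_set_def by blast
  qed
  with T(1) show "\<exists>X. finite X \<and> (\<forall>L'\<in>F. L' \<inter> X = L \<inter> X \<longrightarrow> L' = L)"
    by (intro exI[of _ "fst ` T"]) simp
next
  assume "\<exists>X. finite X \<and> (\<forall>L'\<in>F. L' \<inter> X = L \<inter> X \<longrightarrow> L' = L)"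
  then obtain X where X: "finite X" "\<forall>L'\<in>F. L' \<inter> X = L \<inter> X \<longrightarrow> L' = L"
    by blast
  \<comment> \<open>Labelling each point of \<open>X\<close> by \<open>L\<close> makes consistency
    with \<open>L'\<close> the same as agreement on \<open>X\<close>.\<close>
  define T where "T = (\<lambda>n. (n, if n \<in> L then Plus else Minus)) ` X"
  have "positives T = L \<inter> X" "negatives T = X - L"
    unfolding positives_def negatives_def T_def by (auto split: if_splits)
  then have cons: "consistent T L' \<longleftrightarrow> L' \<inter> X = L \<inter> X" for L'
    unfolding consistent_def by blast
  have "teaching_set T L F"
    using X(2) unfolding teaching_set_def cons by blast
  moreover have "finite T"
    using X(1) by (simp add: T_def)
  ultimately have "TD L F \<le> enat (card T)"
    unfolding TD_def by (intro Inf_lower) blast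
  also have "\<dots> < \<infinity>" by simp
  finally show "TD L F < \<infinity>" .
qed

text \<open>A finite set lies below some \<open>n\<close>, and testing more points still separates.
  The quantifier over finite sets thus becomes a number quantifier.\<close>

lemma TD_finite_iff_initial_segment:
  "TD L F < \<infinity> \<longleftrightarrow> (\<exists>n. \<forall>L'\<in>F. (\<forall>y<n. y \<in> L' \<longleftrightarrow> y \<in> L) \<longrightarrow> L' = L)"
proof
  assume "TD L F < \<infinity>"
  then obtain X where X: "finite X" "\<forall>L'\<in>F. L' \<inter> X = L \<inter> X \<longrightarrow> L' = L"
    unfolding TD_finite_iff by blast
  from X(1) obtain n where n: "X \<subseteq> {..<n}"
    using finite_nat_iff_bounded by blast
  show "\<exists>n. \<forall>L'\<in>F. (\<forall>y<n. y \<in> L' \<longleftrightarrow> y \<in> L) \<longrightarrow> L' = L"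
  proof (intro exI[of _ n] ballI impI)
    fix L' assume "L' \<in> F" "\<forall>y<n. y \<in> L' \<longleftrightarrow> y \<in> L"
    moreover from this(2) n have "L' \<inter> X = L \<inter> X" by auto
    ultimately show "L' = L" using X(2) by simp
  qed
next
  assume "\<exists>n. \<forall>L'\<in>F. (\<forall>y<n. y \<in> L' \<longleftrightarrow> y \<in> L) \<longrightarrow> L' = L"
  then obtain n where n: "\<And>L'. L' \<in> F \<Longrightarrow> \<forall>y<n. y \<in> L' \<longleftrightarrow> y \<in> L \<Longrightarrow> L' = L"
    by blast
  show "TD L F < \<infinity>"
    unfolding TD_finite_iff
  proof (intro exI[of _ "{..<n}"] conjI ballI impI)
    fix L' assume "L' \<in> F" "L' \<inter> {..<n} = L \<inter> {..<n}"
    then show "L' = L" by (intro n) (auto simp: set_eq_iff)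
  qed simp
qed

section \<open>The upper bound\<close>

text \<open>By monotonicity each single \<open>y\<close> changes its status at most once; for
  finitely many \<open>y\<close> the largest of the stages works.\<close>

lemma approximation_eventually_correct:
  fixes A :: "nat \<Rightarrow> nat \<Rightarrow> bool"
  assumes mono: "\<And>s t y. A s y \<Longrightarrow> s \<le> t \<Longrightarrow> A t y"
    and L: "\<And>y. y \<in> L \<longleftrightarrow> (\<exists>s. A s y)"
  shows "\<exists>t0. \<forall>t\<ge>t0. \<forall>y<n. A t y \<longleftrightarrow> y \<in> L"
proof (induction n)
  case (Suc n)
  then obtain t0 where t0: "\<And>t y. t \<ge> t0 \<Longrightarrow> y < n \<Longrightarrow> A t y \<longleftrightarrow> y \<in> L"
    by blast
  obtain t1 where t1: "\<And>t. t \<ge> t1 \<Longrightarrow> A t n \<longleftrightarrow> n \<in> L"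
    using mono L by metis
  show ?case
  proof (intro exI[of _ "max t0 t1"] allI impI)
    fix t y assume "max t0 t1 \<le> t" "y < Suc n"
    then show "A t y \<longleftrightarrow> y \<in> L"
      using t0 t1 by (cases "y = n") auto
  qed
qed simp

text \<open>
  Both a difference below \<open>n\<close> and equality persist in the limit of the approximations, so their
  disjunction becomes a single \<open>\<forall>\<exists>\<close> statement with decidable matrix.
\<close>

lemma agree_imp_eq_iff_approximation:
  fixes A A' :: "nat \<Rightarrow> nat \<Rightarrow> bool"
  assumes mono: "\<And>s t y. A s y \<Longrightarrow> s \<le> t \<Longrightarrow> A t y"
    and L: "\<And>y. y \<in> L \<longleftrightarrow> (\<exists>s. A s y)"
    and mono': "\<And>s t y. A' s y \<Longrightarrow> s \<le> t \<Longrightarrow> A' t y"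
    and L': "\<And>y. y \<in> L' \<longleftrightarrow> (\<exists>s. A' s y)"
  shows "((\<forall>y<n. y \<in> L' \<longleftrightarrow> y \<in> L) \<longrightarrow> L' = L) \<longleftrightarrow>
    (\<forall>s. \<exists>t. s \<le> t \<and> ((\<exists>y<n. \<not> (A t y \<longleftrightarrow> A' t y)) \<or>
      (\<forall>y<s. (A s y \<longrightarrow> A' t y) \<and> (A' s y \<longrightarrow> A t y))))"
    (is "?eq \<longleftrightarrow> (\<forall>s. \<exists>t. s \<le> t \<and> (?diff t \<or> ?sub s t))")
proof -
  have correct: "\<exists>t\<ge>s. \<forall>t'\<ge>t. \<forall>y<n. (A t' y \<longleftrightarrow> y \<in> L) \<and> (A' t' y \<longleftrightarrow> y \<in> L')" for s n
  proof -
    have "\<exists>t0. \<forall>t\<ge>t0. \<forall>y<n. A t y \<longleftrightarrow> y \<in> L"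
      by (rule approximation_eventually_correct, erule mono, assumption, rule L)
    moreover have "\<exists>t0. \<forall>t\<ge>t0. \<forall>y<n. A' t y \<longleftrightarrow> y \<in> L'"
      by (rule approximation_eventually_correct, erule mono', assumption, rule L')
    ultimately obtain t0 t1 where
      "\<forall>t\<ge>t0. \<forall>y<n. A t y \<longleftrightarrow> y \<in> L" "\<forall>t\<ge>t1. \<forall>y<n. A' t y \<longleftrightarrow> y \<in> L'"
      by blast
    then show ?thesis
      by (intro exI[of _ "max s (max t0 t1)"]) simp
  qed
  show ?thesis
  proof
    assume eq: ?eq
    show "\<forall>s. \<exists>t. s \<le> t \<and> (?diff t \<or> ?sub s t)"
    proof
      fix s
      \<comment> \<open>Correctness below \<open>n\<close> reveals a difference, correctness below
        \<open>s\<close> gives the inclusions; hence \<open>max n s\<close>.\<close>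
      obtain t where t: "t \<ge> s"
        "\<And>y. y < max n s \<Longrightarrow> (A t y \<longleftrightarrow> y \<in> L) \<and> (A' t y \<longleftrightarrow> y \<in> L')"
        using correct[of s "max n s"] by blast
      have "?sub s t" if "L' = L"
      proof (intro allI impI)
        fix y assume "y < s"
        then have "A t y \<longleftrightarrow> y \<in> L" "A' t y \<longleftrightarrow> y \<in> L"
          using t(2)[of y] that by simp_all
        moreover have "y \<in> L" if "A s y \<or> A' s y"
          using that \<open>L' = L\<close> L[of y] L'[of y] by blast
        ultimately show "(A s y \<longrightarrow> A' t y) \<and> (A' s y \<longrightarrow> A t y)"
          by blast
      qed
      moreover have "?diff t" if "\<not> (\<forall>y<n. y \<in> L' \<longleftrightarrow> y \<in> L)"
      proof -
        from that obtain y where "y < n" "\<not> (y \<in> L' \<longleftrightarrow> y \<in> L)" by blast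
        with t(2)[of y] show ?thesis by (intro exI[of _ y]) simp
      qed
      ultimately show "\<exists>t. s \<le> t \<and> (?diff t \<or> ?sub s t)"
        using t(1) eq by blast
    qed
  next
    assume R: "\<forall>s. \<exists>t. s \<le> t \<and> (?diff t \<or> ?sub s t)"
    show ?eq
    proof
      assume agree: "\<forall>y<n. y \<in> L' \<longleftrightarrow> y \<in> L"
      have "y \<in> L' \<longleftrightarrow> y \<in> L" for y
      proof -
        \<comment> \<open>\<open>s\<close> exceeds \<open>y\<close>, so that \<open>?sub\<close>
          tests \<open>y\<close>, and from \<open>s\<close> on both approximations are correct at
          \<open>y\<close> and below \<open>n\<close>.\<close>
        obtain s where s: "s \<ge> Suc y"
          "\<And>t z. t \<ge> s \<Longrightarrow> z < max n (Suc y) \<Longrightarrow> (A t z \<longleftrightarrow> z \<in> L) \<and> (A' t z \<longleftrightarrow> z \<in> L')"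
          using correct[of "Suc y" "max n (Suc y)"] by blast
        from R obtain t where t: "t \<ge> s" "?diff t \<or> ?sub s t"
          by blast
        have "\<not> ?diff t"
          using s(2)[OF t(1)] agree by simp
        with t(2) have "?sub s t" by blast
        then show ?thesis
          using s(1) s(2)[of s y] s(2)[OF t(1), of y] by auto
      qed
      then show "L' = L" by blast
    qed
  qed
qed

text \<open>Quantifying over indices instead of members gives the prefix
  \<open>\<forall>j. \<exists>n. \<forall>j' s. \<exists>t\<close>. Pairing merges \<open>j'\<close>
  and \<open>s\<close> into one variable.\<close>

lemma Pi_set_4_I_TD_all:
  assumes "uniformly_re W"
  shows "Pi_set 4 (I_TD_all W)"
proof -
  obtain P where P: "recursive_rel 2 P"
    and W: "\<And>e x. x \<in> W e \<longleftrightarrow> (\<exists>s. P [s, prod_encode (e, x)])"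
    using assms unfolding uniformly_re_iff by blast
  \<comment> \<open>Bounding the search by \<open>t\<close> makes the approximation decidable and
    monotone.\<close>
  define A where "A e j t y \<longleftrightarrow> (\<exists>r<t. P [r, prod_encode (e, prod_encode (j, y))])" for e j t y
  have mono: "A e j s y \<Longrightarrow> s \<le> t \<Longrightarrow> A e j t y" for e j s t y
    unfolding A_def by (meson less_le_trans)
  have lang: "y \<in> language W e j \<longleftrightarrow> (\<exists>s. A e j s y)" for e j y
    unfolding language_def A_def W by (auto intro: lessI)
  define M where "M e j n j' s t \<longleftrightarrow> s \<le> t \<and> ((\<exists>y<n. \<not> (A e j t y \<longleftrightarrow> A e j' t y)) \<or>
      (\<forall>y<s. (A e j s y \<longrightarrow> A e j' t y) \<and> (A e j' s y \<longrightarrow> A e j t y)))" for e j n j' s t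
  \<comment> \<open>The list is \<open>[t, c, n, j, e]\<close>, where \<open>c\<close> codes the
    pair of \<open>j'\<close> and \<open>s\<close>.\<close>
  define R where "R xs \<longleftrightarrow> M (xs ! 4) (xs ! 3) (xs ! 2)
      (fst (prod_decode (xs ! 1))) (snd (prod_decode (xs ! 1))) (xs ! 0)" for xs
  have "recursive_rel 5 R"
    unfolding R_def M_def A_def
    by (intro recursive_rel_intros recursive_rel_app2[OF P] recursive_fn_intros; simp)
  moreover have "e \<in> I_TD_all W \<longleftrightarrow> (\<forall>j. \<exists>n. \<forall>c. \<exists>t. R [t, c, n, j, e])" for e
  proof -
    have "e \<in> I_TD_all W \<longleftrightarrow> (\<forall>j. \<exists>n. \<forall>j'.
        (\<forall>y<n. y \<in> language W e j' \<longleftrightarrow> y \<in> language W e j) \<longrightarrow> language W e j' = language W e j)"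
      unfolding I_TD_all_def family_def TD_finite_iff_initial_segment by auto
    also have "\<dots> \<longleftrightarrow> (\<forall>j. \<exists>n. \<forall>j' s. \<exists>t. M e j n j' s t)"
      unfolding M_def
      by (subst agree_imp_eq_iff_approximation[OF _ lang _ lang]) (use mono in blast)+
    also have "\<dots> \<longleftrightarrow> (\<forall>j. \<exists>n. \<forall>c. \<exists>t. M e j n (fst (prod_decode c)) (snd (prod_decode c)) t)"
      by (metis prod_encode_inverse fst_conv snd_conv)
    finally show ?thesis
      by (simp add: R_def)
  qed
  ultimately show ?thesis
    unfolding Pi_set_4_iff by blast
qed

section \<open>Hardness\<close>

text \<open>Row \<open>0\<close> belongs to every language of a column, so it marks the column.\<close>

definition column :: "(nat \<Rightarrow> nat \<Rightarrow> nat \<Rightarrow> bool) \<Rightarrow> nat \<Rightarrow> nat \<Rightarrow> nat set" where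
  "column Q a i = {n. i = 0 \<or> n < i \<or> (\<exists>b<i. Q a b n)}"

definition column_language :: "(nat \<Rightarrow> nat \<Rightarrow> nat \<Rightarrow> bool) \<Rightarrow> nat \<Rightarrow> nat \<Rightarrow> nat set" where
  "column_language Q a i = (\<lambda>n. prod_encode (a, n)) ` column Q a i"

lemma mem_column_language:
  "prod_encode (a', n) \<in> column_language Q a i \<longleftrightarrow> a' = a \<and> n \<in> column Q a i"
  by (auto simp: column_language_def)

text \<open>\<open>Q a b n\<close> abstracts the claim that \<open>b\<close> works up to
  \<open>n\<close>. By \<open>anti\<close>, every \<open>column Q a i\<close> is an initial
  segment.\<close>

lemma column_language_TD:
  assumes anti: "\<And>a b m n. Q a b n \<Longrightarrow> m \<le> n \<Longrightarrow> Q a b m"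
  defines "F \<equiv> {column_language Q a i |a i. True}"
  shows "(\<forall>L\<in>F. TD L F < \<infinity>) \<longleftrightarrow> (\<forall>a. \<exists>b. \<forall>n. Q a b n)"
proof
  have down: "m \<in> column Q a i" if "n \<in> column Q a i" "m \<le> n" for a i m n
    using that anti unfolding column_def by (auto dest: le_less_trans)
  show "\<forall>L\<in>F. TD L F < \<infinity>" if Q: "\<forall>a. \<exists>b. \<forall>n. Q a b n"
  proof
    fix L assume "L \<in> F"
    then obtain a i where L: "L = column_language Q a i"
      unfolding F_def by blast
    show "TD L F < \<infinity>"
    proof (cases "column Q a i = UNIV")
      case True
      obtain b where b: "\<And>n. Q a b n" using Q by blast
      have "\<forall>i. \<exists>n. column Q a i \<noteq> UNIV \<longrightarrow> n \<notin> column Q a i"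
        by blast
      then obtain h where h: "\<And>i. column Q a i \<noteq> UNIV \<Longrightarrow> h i \<notin> column Q a i"
        by metis
      \<comment> \<open>Row \<open>0\<close> identifies the column, and \<open>h i\<close> refutes
        the segment with index \<open>i \<le> b\<close> if it is proper.\<close>
      let ?X = "(\<lambda>n. prod_encode (a, n)) ` insert 0 (h ` {..b})"
      have eq: "L' = L" if L': "L' \<in> F" "L' \<inter> ?X = L \<inter> ?X" for L'
      proof -
        obtain a' i' where i': "L' = column_language Q a' i'"
          using L' unfolding F_def by blast
        have mem: "prod_encode (a, n) \<in> L'" if "n \<in> insert 0 (h ` {..b})" for n
        proof -
          from that have "prod_encode (a, n) \<in> ?X" by (rule imageI)
          moreover have "prod_encode (a, n) \<in> L"
            using True by (simp add: L mem_column_language)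
          ultimately show ?thesis using L'(2) by blast
        qed
        from mem[of 0] have "a' = a"
          by (simp add: i' mem_column_language)
        moreover have "column Q a i' = UNIV"
        proof (rule ccontr)
          assume neq: "column Q a i' \<noteq> UNIV"
          \<comment> \<open>For a larger index, \<open>b\<close> itself is an admissible witness and
            makes the segment the whole column.\<close>
          then have "i' \<le> b"
            using b unfolding column_def by (auto simp: not_le)
          with mem[of "h i'"] h[OF neq] show False
            by (simp add: i' mem_column_language)
        qed
        ultimately show ?thesis
          using True by (simp add: i' L column_language_def)
      qed
      show ?thesis
        unfolding TD_finite_iff
      proof (intro exI[of _ ?X] conjI ballI impI)
        show "finite ?X" by simp
      qed (rule eq)
    next
      case False
      define m where "m = (LEAST n. n \<notin> column Q a i)"
      have "\<exists>n. n \<notin> column Q a i"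
        using False by blast
      then have m: "m \<notin> column Q a i" "\<And>n. n < m \<Longrightarrow> n \<in> column Q a i"
        unfolding m_def by (rule LeastI_ex, blast dest: not_less_Least)
      \<comment> \<open>This makes \<open>m\<close> positive, so that \<open>m - 1\<close> is a true
        predecessor.\<close>
      have zero: "0 \<in> column Q a i" for a i
        by (auto simp: column_def)
      with m(1) have "m > 0"
        by (metis gr0I)
      let ?X = "{prod_encode (a, m - 1), prod_encode (a, m)}"
      have eq: "L' = L" if L': "L' \<in> F" "L' \<inter> ?X = L \<inter> ?X" for L'
      proof -
        obtain a' i' where i': "L' = column_language Q a' i'"
          using L' unfolding F_def by blast
        have "z \<in> L' \<longleftrightarrow> z \<in> L" if "z \<in> ?X" for z
          using that L'(2) by blast
        then have "prod_encode (a, m - 1) \<in> L'" "prod_encode (a, m) \<notin> L'"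
          using m \<open>m > 0\<close> by (simp_all add: L mem_column_language)
        then have "a' = a" and m': "m - 1 \<in> column Q a i'" "m \<notin> column Q a i'"
          by (auto simp: i' mem_column_language)
        \<comment> \<open>Downward closure: the last element and the first gap determine a
          segment.\<close>
        have "n \<in> column Q a j \<longleftrightarrow> n < m"
          if "m - 1 \<in> column Q a j" "m \<notin> column Q a j" for n j
          using that \<open>m > 0\<close> down[of "m - 1" a j n] down[of n a j m] by force
        then have "column Q a i' = column Q a i"
          using m' m(1) m(2)[of "m - 1"] \<open>m > 0\<close> by (auto simp: set_eq_iff)
        with \<open>a' = a\<close> show ?thesis
          by (simp add: i' L column_language_def)
      qed
      show ?thesis
        unfolding TD_finite_iff
      proof (intro exI[of _ ?X] conjI ballI impI)
        show "finite ?X" by simp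
      qed (rule eq)
    qed
  qed
  show "\<forall>a. \<exists>b. \<forall>n. Q a b n" if TD: "\<forall>L\<in>F. TD L F < \<infinity>"
  proof (rule ccontr)
    assume "\<not> (\<forall>a. \<exists>b. \<forall>n. Q a b n)"
    then obtain a h where h: "\<And>b. \<not> Q a b (h b)"
      by metis
    have "TD (column_language Q a 0) F < \<infinity>"
      using TD unfolding F_def by blast
    then obtain X where X: "finite X"
      "\<forall>L'\<in>F. L' \<inter> X = column_language Q a 0 \<inter> X \<longrightarrow> L' = column_language Q a 0"
      unfolding TD_finite_iff by blast
    have "finite ((\<lambda>z. snd (prod_decode z)) ` X)"
      using X(1) by simp
    then obtain i where i: "(\<lambda>z. snd (prod_decode z)) ` X \<subseteq> {..<i}"
      using finite_nat_iff_bounded by blast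
    \<comment> \<open>The rows of \<open>X\<close> lie below \<open>i\<close>. The competitor gets
      index \<open>Suc i\<close>, as index \<open>0\<close> would denote the whole column.\<close>
    have "n < Suc i" if "prod_encode (a, n) \<in> X" for n
      using i that by (force simp: subset_iff)
    then have "column_language Q a (Suc i) \<inter> X = column_language Q a 0 \<inter> X"
      by (auto simp: column_language_def column_def)
    then have "column_language Q a (Suc i) = column_language Q a 0"
      by (intro X(2)[rule_format]) (auto simp: F_def)
    then have univ: "n \<in> column Q a (Suc i)" for n
      using mem_column_language[of a n Q a] by (auto simp: column_def)
    \<comment> \<open>\<open>N\<close> is not below \<open>Suc i\<close>, so it needs a witness
      \<open>b \<le> i\<close>; and \<open>N\<close> dominates each such \<open>h b\<close>, so
      \<open>anti\<close> carries the witness down to \<open>h b\<close>.\<close>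
    define N where "N = Suc i + sum h {..<Suc i}"
    from univ[of N] obtain b where b: "b < Suc i" "Q a b N"
      unfolding column_def N_def by auto
    have "h b \<le> sum h {..<Suc i}"
      using b(1) by (intro member_le_sum) auto
    then have "Q a b (h b)"
      by (intro anti[OF b(2)]) (simp add: N_def)
    with h show False by blast
  qed
qed

text \<open>The column families are r.e. uniformly in \<open>x\<close>, so acceptability supplies a
  recursive \<open>f\<close> sending \<open>x\<close> to an index of the family.\<close>

lemma many_one_reducible_I_TD_all:
  assumes W: "acceptable_numbering W" and B: "Pi_set 4 B"
  shows "many_one_reducible B (I_TD_all W)"
proof -
  obtain R where R: "recursive_rel 5 R"
    and B: "\<And>x. x \<in> B \<longleftrightarrow> (\<forall>a. \<exists>b. \<forall>c. \<exists>d. R [d, c, b, a, x])"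
    using B unfolding Pi_set_4_iff by blast
  \<comment> \<open>The bounded quantifier over \<open>c\<close> makes \<open>Q\<close> antitone in
    \<open>n\<close>.\<close>
  define Q where "Q x a b n \<longleftrightarrow> (\<forall>c<Suc n. \<exists>d. R [d, c, b, a, x])" for x a b n
  \<comment> \<open>The language with index \<open>prod_encode (a, i)\<close> is
    \<open>column_language (Q x) a i\<close>.\<close>
  define V where "V x = {z. snd (prod_decode z) \<in>
    column_language (Q x) (fst (prod_decode (fst (prod_decode z))))
      (snd (prod_decode (fst (prod_decode z))))}" for x
  \<comment> \<open>Collection: finitely many witnesses have a common bound \<open>w\<close>, so the
    unbounded quantifier moves to the front of a decidable matrix.\<close>
  have bound: "(\<forall>c<Suc n. \<exists>d. R [d, c, b, a, x]) \<longleftrightarrow> (\<exists>w. \<forall>c<Suc n. \<exists>d<w. R [d, c, b, a, x])"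
    for n b a x
  proof
    assume "\<forall>c<Suc n. \<exists>d. R [d, c, b, a, x]"
    then obtain h where h: "\<And>c. c < Suc n \<Longrightarrow> R [h c, c, b, a, x]"
      by metis
    have "h c < Suc (sum h {..<Suc n})" if "c < Suc n" for c
      using that by (intro le_imp_less_Suc member_le_sum) auto
    with h show "\<exists>w. \<forall>c<Suc n. \<exists>d<w. R [d, c, b, a, x]"
      by blast
  qed blast
  define S where "S w x a i a' n \<longleftrightarrow>
      a' = a \<and> (i = 0 \<or> n < i \<or> (\<exists>b<i. \<forall>c<Suc n. \<exists>d<w. R [d, c, b, a, x]))"
    for w x a i a' n
  \<comment> \<open>The second entry codes \<open>x\<close> together with \<open>z\<close>, and
    \<open>z\<close> in turn codes the pairs of \<open>a\<close>, \<open>i\<close> and of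
    \<open>a'\<close>, \<open>n\<close>.\<close>
  define S' where "S' xs \<longleftrightarrow> S (xs ! 0) (fst (prod_decode (xs ! 1)))
      (fst (prod_decode (fst (prod_decode (snd (prod_decode (xs ! 1)))))))
      (snd (prod_decode (fst (prod_decode (snd (prod_decode (xs ! 1)))))))
      (fst (prod_decode (snd (prod_decode (snd (prod_decode (xs ! 1)))))))
      (snd (prod_decode (snd (prod_decode (snd (prod_decode (xs ! 1)))))))" for xs
  have "recursive_rel 2 S'"
    unfolding S'_def S_def
    by (intro recursive_rel_intros recursive_rel_app5[OF R] recursive_fn_intros; simp)
  moreover have "z \<in> V x \<longleftrightarrow> (\<exists>w. S' [w, prod_encode (x, z)])" for x z
  proof -
    obtain a i a' n where z: "z = prod_encode (prod_encode (a, i), prod_encode (a', n))"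
      by (metis prod_decode_inverse surj_pair)
    have "(\<exists>w. S w x a i a' n) \<longleftrightarrow> a' = a \<and> n \<in> column (Q x) a i"
      unfolding S_def column_def Q_def bound by blast
    then show ?thesis
      by (simp add: z V_def S'_def mem_column_language)
  qed
  ultimately have "uniformly_re V"
    unfolding uniformly_re_iff by blast
  then obtain f where f: "recursive f" "\<And>x. V x = W (f x)"
    using W unfolding acceptable_numbering_def by blast
  have "x \<in> B \<longleftrightarrow> f x \<in> I_TD_all W" for x
  proof -
    have lang: "language W (f x) (prod_encode (a, i)) = column_language (Q x) a i" for a i
      by (auto simp: language_def V_def simp flip: f(2))
    \<comment> \<open>Every index codes a pair, so no further languages occur.\<close>
    have "family W (f x) = {column_language (Q x) a i |a i. True}" (is "_ = ?F")
    proof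
      show "family W (f x) \<subseteq> ?F"
      proof
        fix L assume "L \<in> family W (f x)"
        then obtain j where "L = language W (f x) j"
          unfolding family_def by blast
        then show "L \<in> ?F"
          using lang by (metis (mono_tags, lifting) mem_Collect_eq prod_decode_inverse surj_pair)
      qed
      show "?F \<subseteq> family W (f x)"
        unfolding family_def by (auto simp flip: lang)
    qed
    then have "f x \<in> I_TD_all W \<longleftrightarrow> (\<forall>a. \<exists>b. \<forall>n. Q x a b n)"
      using column_language_TD[of "Q x"] by (simp add: I_TD_all_def Q_def)
    \<comment> \<open>Taking \<open>n = c\<close> recovers the condition for each single
      \<open>c\<close>.\<close>
    then show ?thesis
      unfolding B Q_def by (meson lessI)
  qed
  with f(1) show ?thesis
    unfolding many_one_reducible_def by blast
qed

theorem theorem4: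
  fixes W :: "nat \<Rightarrow> nat set"
  assumes "acceptable_numbering W"
  shows "Pi_complete 4 (I_TD_all W)"
  using assms Pi_set_4_I_TD_all many_one_reducible_I_TD_all
  unfolding Pi_complete_def acceptable_numbering_def by blast

end
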